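(* Suppose the components of $\hat{\boldsymbol w}=\hat{\boldsymbol p}\circ\hat{\boldsymbol p}$ are pairwise distinct, and let $(S,N,C)$ be a valid SCG-tuple with respect to $\hat{\boldsymbol w}$. Case 1. If $|N|>d-k$, then $(S,N,C)$ is minimal if and only if $S=\emptyset$. Case 2. If $|N|\le d-k$ and $C=\emptyset$, then $(S,N,C)$ is minimal if and only if $N=\emptyset$ and $\max_{i\in S}\hat w_i<\hat w_{[1]}$. Case 3. If $|N|\le d-k$ and $C\neq\emptyset$, then $(S,N,C)$ is minimal if and only if the following two conditions hold simultaneously: (1) $N=\emptyset$, or $\min_{i\in N}\hat w_i\ge\min_{i\in C}\hat w_i$; (2) $S=\emptyset$, or there exists an index $j\in[\![d]\!]$, $j\notin S\cup N\cup C$, such that $\min_{i\in C}\hat w_i>\hat w_j>\max_{i\in S}\hat w_i$.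
   Context: Let $d,k$ be integers with $1\le k\le d$, write $[\![d]\!]=\{1,\dots,d\}$, let $\mathcal L:\mathbb R^d\to\mathbb R$ be a convex loss and $\gamma>0$. The sparse ridge regression problem is $v^*=\min_{\boldsymbol\beta\in\mathbb R^d}\{\mathcal L(\boldsymbol\beta)+\gamma\|\boldsymbol\beta\|_2^2:\ \|\boldsymbol\beta\|_0\le k\}$, where $\|\boldsymbol\beta\|_0=|\{i:\beta_i\ne 0\}|$. Its relaxation value is $$v_{\rm conic}=\max_{\boldsymbol p\in\mathbb R^d}\ \min_{\boldsymbol\beta\in\mathbb R^d,\ \boldsymbol z\in[0,1]^d,\ \boldsymbol 1^\top\boldsymbol z\le k}\ \mathcal L(\boldsymbol\beta)+\gamma\sum_{i=1}^d\Big(p_i\beta_i-\frac{p_i^2z_i}{4}\Big),$$ a lower bound on $v^*$; $\hat{\boldsymbol p}$ is an optimal solution of the outer maximization, and $\hat{\boldsymbol w}=\hat{\boldsymbol p}\circ\hat{\boldsymbol p}$ (entrywise square). Let $v_{\rm ub}$ be any upper bound of $v^*$ and $\mathrm{gap}=v_{\rm ub}-v_{\rm conic}\ge0$. For a vector $\boldsymbol x$, $x_{[j]}$ denotes its $j$-th largest component, and $\boldsymbol x_R$ its restriction to the index set $R$. SCG-tuple: let $S,N\subseteq[\![d]\!]$ be disjoint with $|S|\le k$, let $R=[\![d]\!]\setminus(S\cup N)$ and $c=\min\{k-|S|,|R|\}$. The triple $(S,N,C)$ is an SCG-tuple with respect to $\hat{\boldsymbol w}$ if $C=\{i\in R:\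 \hat w_i\ge(\hat{\boldsymbol w}_R)_{[c]}\}$ (and $C=\emptyset$ if $c=0$). It is valid if in addition $\sum_{i=1}^k\hat w_{[i]}-\sum_{i\in S}\hat w_i-\sum_{i\in C}\hat w_i>\frac4\gamma\,\mathrm{gap}$. A valid SCG-tuple $(S,N,C)$ is minimal if both of the following hold: (1) $N=\emptyset$, or for every $i\in N$ the triple $(S,N\setminus\{i\},C)$ is not a valid SCG-tuple; (2) $S=\emptyset$, or for every $i\in S$ the triple $(S\setminus\{i\},N,C\cup\{i\})$ is not a valid SCG-tuple. *)

theory Defs
  imports "HOL-Analysis.Analysis" "HOL-Library.Multiset"
begin

definition l0_norm :: "real ^ 'n \<Rightarrow> nat" where
  "l0_norm b = card {i. b $ i \<noteq> 0}"

(* The optimal values below live in the extended reals because the inner minimum of the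
   relaxation is minus infinity for some p (e.g. for affine L), and there
   the real-valued Inf would be a junk value. *)

definition ridge_value :: "(real ^ 'n \<Rightarrow> real) \<Rightarrow> real \<Rightarrow> nat \<Rightarrow> ereal" where
  "ridge_value L \<gamma> k = (INF b \<in> {b. l0_norm b \<le> k}. ereal (L b + \<gamma> * (norm b)\<^sup>2))"

definition conic_inner :: "(real ^ 'n \<Rightarrow> real) \<Rightarrow> real \<Rightarrow> nat \<Rightarrow> real ^ 'n \<Rightarrow> ereal" where
  "conic_inner L \<gamma> k p =
     (INF (b, z) \<in> UNIV \<times> {z :: real ^ 'n. (\<forall>i. 0 \<le> z $ i \<and> z $ i \<le> 1) \<and> (\<Sum>i\<in>UNIV. z $ i) \<le> real k}.
        ereal (L b + \<gamma> * (\<Sum>i\<in>UNIV. p $ i * b $ i - (p $ i)\<^sup>2 * z $ i / 4)))"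

definition conic_value :: "(real ^ 'n \<Rightarrow> real) \<Rightarrow> real \<Rightarrow> nat \<Rightarrow> ereal" where
  "conic_value L \<gamma> k = (SUP p. conic_inner L \<gamma> k p)"

definition conic_optimal :: "(real ^ 'n \<Rightarrow> real) \<Rightarrow> real \<Rightarrow> nat \<Rightarrow> real ^ 'n \<Rightarrow> bool" where
  "conic_optimal L \<gamma> k p \<longleftrightarrow> (\<forall>q. conic_inner L \<gamma> k q \<le> conic_inner L \<gamma> k p)"

(* The j-th largest component (counted from 1, with multiplicity) of x restricted to R;
   meaningful only for 1 \<le> j \<le> card R. *)
definition nth_largest :: "real ^ 'n \<Rightarrow> 'n set \<Rightarrow> nat \<Rightarrow> real" where
  "nth_largest x R j =
     rev (sorted_list_of_multiset (image_mset (\<lambda>i. x $ i) (mset_set R))) ! (j - 1)"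

definition scg_tuple :: "nat \<Rightarrow> real ^ 'n \<Rightarrow> 'n set \<Rightarrow> 'n set \<Rightarrow> 'n set \<Rightarrow> bool" where
  "scg_tuple k w S N C \<longleftrightarrow>
     S \<inter> N = {} \<and> card S \<le> k \<and>
     (let R = UNIV - (S \<union> N); c = min (k - card S) (card R)
      in C = (if c = 0 then {} else {i \<in> R. w $ i \<ge> nth_largest w R c}))"

definition valid_scg_tuple ::
  "nat \<Rightarrow> real \<Rightarrow> ereal \<Rightarrow> real ^ 'n \<Rightarrow> 'n set \<Rightarrow> 'n set \<Rightarrow> 'n set \<Rightarrow> bool" where
  "valid_scg_tuple k \<gamma> gap w S N C \<longleftrightarrow>
     scg_tuple k w S N C \<and>
     ereal ((\<Sum>j=1..k. nth_largest w UNIV j) - (\<Sum>i\<in>S. w $ i) - (\<Sum>i\<in>C. w $ i))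
       > ereal (4 / \<gamma>) * gap"

definition minimal_scg_tuple ::
  "nat \<Rightarrow> real \<Rightarrow> ereal \<Rightarrow> real ^ 'n \<Rightarrow> 'n set \<Rightarrow> 'n set \<Rightarrow> 'n set \<Rightarrow> bool" where
  "minimal_scg_tuple k \<gamma> gap w S N C \<longleftrightarrow>
     valid_scg_tuple k \<gamma> gap w S N C \<and>
     (N = {} \<or> (\<forall>i\<in>N. \<not> valid_scg_tuple k \<gamma> gap w S (N - {i}) C)) \<and>
     (S = {} \<or> (\<forall>i\<in>S. \<not> valid_scg_tuple k \<gamma> gap w (S - {i}) N (C \<union> {i})))"

lemma conic_value_le_ridge_value:
  fixes L :: "real ^ 'n \<Rightarrow> real"
  assumes "\<gamma> > 0"
  shows "conic_value L \<gamma> k \<le> ridge_value L \<gamma> k"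
  unfolding conic_value_def ridge_value_def
proof (rule SUP_least, rule INF_greatest)
  fix p b :: "real ^ 'n"
  assume "b \<in> {b. l0_norm b \<le> k}"
  then have b: "card {i. b $ i \<noteq> 0} \<le> k" by (simp add: l0_norm_def)
  define z :: "real ^ 'n" where "z = (\<chi> i. if b $ i \<noteq> 0 then 1 else 0)"
  have z: "(\<forall>i. 0 \<le> z $ i \<and> z $ i \<le> 1) \<and> (\<Sum>i\<in>UNIV. z $ i) \<le> real k"
    using b by (auto simp: z_def sum.If_cases)
  have "p $ i * b $ i - (p $ i)\<^sup>2 * z $ i / 4 \<le> (b $ i)\<^sup>2" for i
    using zero_le_power2[of "b $ i - p $ i / 2"]
    by (cases "b $ i = 0") (simp_all add: z_def power2_eq_square algebra_simps)
  then have "(\<Sum>i\<in>UNIV. p $ i * b $ i - (p $ i)\<^sup>2 * z $ i / 4) \<le> (\<Sum>i\<in>UNIV. (b $ i)\<^sup>2)"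
    by (intro sum_mono)
  also have "\<dots> = (norm b)\<^sup>2"
    by (simp add: norm_vec_def L2_set_def sum_nonneg)
  finally have le: "L b + \<gamma> * (\<Sum>i\<in>UNIV. p $ i * b $ i - (p $ i)\<^sup>2 * z $ i / 4)
      \<le> L b + \<gamma> * (norm b)\<^sup>2"
    using assms by simp
  show "conic_inner L \<gamma> k p \<le> ereal (L b + \<gamma> * (norm b)\<^sup>2)"
    unfolding conic_inner_def
    by (rule INF_lower2[of "(b, z)"]) (use z le in auto)
qed

corollary gap_nonneg:
  assumes "\<gamma> > 0" and "ridge_value L \<gamma> k \<le> ereal v_ub"
  shows "0 \<le> ereal v_ub - conic_value L \<gamma> k"
  using order_trans[OF conic_value_le_ridge_value[OF assms(1)] assms(2)]
  by (simp add: ereal_diff_positive)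

end

theory Submission
  imports Defs
begin

text \<open>
  Since the components of \<open>w\<close> are distinct, \<open>(S, N, C)\<close> is an SCG-tuple iff \<open>C\<close> is the unique
  upward closed subset of \<open>R\<close> with \<open>c\<close> elements. Removing an index from \<open>N\<close>, or moving one from
  \<open>S\<close> to \<open>C\<close>, leaves the sum over \<open>S \<union> C\<close> unchanged, so validity of the new triple amounts to
  its being an SCG-tuple, and this is decided by comparing the moved index \<open>i\<close>, which joins \<open>R\<close>,
  with the elements of \<open>C\<close>, respectively of \<open>R - C\<close>.
\<close>

text \<open>Replaces the order-statistic threshold of an SCG-tuple by a size and pairwise
  comparisons, which are easy to update when one index joins \<open>R\<close>.\<close>

definition top_set :: "real ^ 'n \<Rightarrow> 'n set \<Rightarrow> nat \<Rightarrow> 'n set \<Rightarrow> bool" where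
  "top_set w R c C \<longleftrightarrow> C \<subseteq> R \<and> card C = c \<and> (\<forall>i\<in>C. \<forall>j\<in>R - C. w $ j < w $ i)"

text \<open>Two distinct finite sets of equal size each have an element outside the other, and these
  two elements would each have to exceed the other.\<close>

lemma top_set_unique:
  fixes w :: "real ^ 'n"
  assumes "top_set w R c C" and "top_set w R c D"
  shows "C = D"
proof (rule ccontr)
  assume "C \<noteq> D"
  moreover have "finite C" "finite D" "card C = card D"
    using assms by (auto simp: top_set_def)
  ultimately have "\<not> C \<subseteq> D" "\<not> D \<subseteq> C"
    by (metis card_subset_eq)+
  then obtain a b where "a \<in> C - D" "b \<in> D - C"
    by blast
  then have "w $ a < w $ b" "w $ b < w $ a"
    using assms unfolding top_set_def by blast+
  then show False by simp
qed

text \<open>Injectivity turns the multiset of values into a set, so its sorted list is strictly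
  increasing and the entries at or above a given one are exactly those from its position to the
  end.\<close>

lemma nth_largest_inj:
  fixes w :: "real ^ 'n"
  assumes inj: "inj_on (($) w) R" and c: "1 \<le> c" "c \<le> card R"
  shows nth_largest_in: "nth_largest w R c \<in> ($) w ` R"
    and card_ge_nth_largest: "card {i \<in> R. nth_largest w R c \<le> w $ i} = c"
proof -
  define xs where "xs = sorted_list_of_set (($) w ` R)"
  have len: "length xs = card R"
    using inj by (simp add: xs_def card_image)
  have sorted: "sorted_wrt (<) xs"
    by (simp add: xs_def)
  have set: "set xs = ($) w ` R"
    by (simp add: xs_def)
  \<comment> \<open>Reversal sends index \<open>c - 1\<close> to \<open>length xs - c\<close>; here
    \<open>1 \<le> c\<close> matters, since \<open>c - 1\<close> is truncated.\<close>
  define m where "m = length xs - c"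
  have m: "m < length xs"
    using c len by (simp add: m_def)
  have "image_mset (($) w) (mset_set R) = mset_set (($) w ` R)"
    using inj by (rule image_mset_mset_set)
  then have nth: "nth_largest w R c = xs ! m"
    using c len
    by (simp add: nth_largest_def xs_def[symmetric] sorted_list_of_mset_set rev_nth m_def)
  show "nth_largest w R c \<in> ($) w ` R"
    using nth m set by (metis nth_mem)
  have le_iff: "xs ! m \<le> xs ! j \<longleftrightarrow> m \<le> j" if "j < length xs" for j
    using sorted_wrt_nth_less[OF sorted, of m j] sorted_wrt_nth_less[OF sorted, of j m] that m
    by (cases m j rule: linorder_cases) auto
  have "($) w ` {i \<in> R. xs ! m \<le> w $ i} = {x \<in> set xs. xs ! m \<le> x}"
    using set by auto
  also have "\<dots> = (!) xs ` {m..<length xs}"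
    using le_iff by (force simp: in_set_conv_nth)
  finally have image: "($) w ` {i \<in> R. xs ! m \<le> w $ i} = (!) xs ` {m..<length xs}" .
  have "card {i \<in> R. xs ! m \<le> w $ i} = card (($) w ` {i \<in> R. xs ! m \<le> w $ i})"
    by (intro card_image[symmetric] inj_on_subset[OF inj]) auto
  also have "\<dots> = card {m..<length xs}"
    unfolding image
    by (intro card_image inj_on_nth) (auto simp: xs_def)
  also have "\<dots> = c"
    using c len by (simp add: m_def)
  finally show "card {i \<in> R. nth_largest w R c \<le> w $ i} = c"
    using nth by simp
qed

lemma top_set_ge_nth_largest:
  fixes w :: "real ^ 'n"
  assumes "inj_on (($) w) R" "c \<le> card R"
  shows "top_set w R c (if c = 0 then {} else {i \<in> R. w $ i \<ge> nth_largest w R c})"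
  using card_ge_nth_largest[OF assms(1), of c] assms(2) by (auto simp: top_set_def)

text \<open>The threshold set is a top set of the right size, and by uniqueness it is the only
  one.\<close>

lemma scg_tuple_iff_top_set:
  fixes w :: "real ^ 'n"
  assumes "inj (($) w)"
  shows "scg_tuple k w S N C \<longleftrightarrow> S \<inter> N = {} \<and> card S \<le> k \<and>
    top_set w (UNIV - (S \<union> N)) (min (k - card S) (card (UNIV - (S \<union> N)))) C"
proof -
  have inj: "inj_on (($) w) A" for A
    using assms by (rule inj_on_subset) simp
  have "C = (if c = 0 then {} else {i \<in> R. w $ i \<ge> nth_largest w R c}) \<longleftrightarrow> top_set w R c C"
    if "c \<le> card R" for R c
    using top_set_ge_nth_largest[OF inj that] top_set_unique by blast
  then show ?thesis
    by (simp add: scg_tuple_def Let_def)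
qed

text \<open>The value is attained at some \<open>a\<close>, and only one index reaches it, so every
  other index lies strictly below.\<close>

lemma nth_largest_1:
  fixes w :: "real ^ 'n"
  assumes inj: "inj_on (($) w) R" and "R \<noteq> {}"
  shows "nth_largest w R 1 = Max (($) w ` R)"
proof -
  have card: "1 \<le> card R"
    using \<open>R \<noteq> {}\<close> by (simp add: Suc_leI card_gt_0_iff)
  obtain a where a: "a \<in> R" "nth_largest w R 1 = w $ a"
    using nth_largest_in[OF inj _ card] by auto
  then obtain b where b: "{i \<in> R. w $ a \<le> w $ i} = {b}"
    using card_ge_nth_largest[OF inj _ card] by (auto simp: card_1_singleton_iff)
  moreover have "a \<in> {i \<in> R. w $ a \<le> w $ i}"
    using a by simp
  ultimately have "b = a"
    by simp
  then have "w $ i \<le> w $ a" if "i \<in> R" for i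
    using b that by (cases "w $ a \<le> w $ i") auto
  then show ?thesis
    using a by (intro Max_eqI[symmetric]) auto
qed

lemma valid_remove_N_iff:
  fixes w :: "real ^ 'n"
  assumes "valid_scg_tuple k \<gamma> gap w S N C"
  shows "valid_scg_tuple k \<gamma> gap w S (N - {i}) C \<longleftrightarrow> scg_tuple k w S (N - {i}) C"
  using assms by (auto simp: valid_scg_tuple_def)

text \<open>The term \<open>w $ i\<close> passes from one subtracted sum to the other;
  \<open>i \<notin> C\<close> ensures that it is really added there.\<close>

lemma valid_move_S_iff:
  fixes w :: "real ^ 'n"
  assumes "valid_scg_tuple k \<gamma> gap w S N C" and "i \<in> S" and "i \<notin> C"
  shows "valid_scg_tuple k \<gamma> gap w (S - {i}) N (C \<union> {i}) \<longleftrightarrow>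
    scg_tuple k w (S - {i}) N (C \<union> {i})"
proof -
  have "(\<Sum>j\<in>S. w $ j) = w $ i + (\<Sum>j\<in>S - {i}. w $ j)"
    using assms by (intro sum.remove) auto
  moreover have "(\<Sum>j\<in>C \<union> {i}. w $ j) = w $ i + (\<Sum>j\<in>C. w $ j)"
    using assms by simp
  ultimately have "x - (\<Sum>j\<in>S - {i}. w $ j) - (\<Sum>j\<in>C \<union> {i}. w $ j)
      = x - (\<Sum>j\<in>S. w $ j) - (\<Sum>j\<in>C. w $ j)" for x
    by simp
  then show ?thesis
    using assms(1) unfolding valid_scg_tuple_def by presburger
qed

theorem proposition3:
  fixes L :: "real ^ 'n \<Rightarrow> real" and \<gamma> v_ub :: real and gap :: ereal
    and k :: nat and p w :: "real ^ 'n" and S N C :: "'n set"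
  assumes "1 \<le> k" and "k \<le> CARD('n)"
    and "convex_on UNIV L" and "\<gamma> > 0"
    and "conic_optimal L \<gamma> k p"
    and "w = (\<chi> i. p $ i * p $ i)"
    and "ridge_value L \<gamma> k \<le> ereal v_ub"
    and "gap = ereal v_ub - conic_value L \<gamma> k"
    and "\<forall>i j. i \<noteq> j \<longrightarrow> w $ i \<noteq> w $ j"
    and "valid_scg_tuple k \<gamma> gap w S N C"
  shows "(card N > CARD('n) - k \<longrightarrow>
            (minimal_scg_tuple k \<gamma> gap w S N C \<longleftrightarrow> S = {}))
       \<and> (card N \<le> CARD('n) - k \<and> C = {} \<longrightarrow>
            (minimal_scg_tuple k \<gamma> gap w S N C \<longleftrightarrow>
               N = {} \<and> Max ((\<lambda>i. w $ i) ` S) < nth_largest w UNIV 1))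
       \<and> (card N \<le> CARD('n) - k \<and> C \<noteq> {} \<longrightarrow>
            (minimal_scg_tuple k \<gamma> gap w S N C \<longleftrightarrow>
               (N = {} \<or> Min ((\<lambda>i. w $ i) ` N) \<ge> Min ((\<lambda>i. w $ i) ` C)) \<and>
               (S = {} \<or> (\<exists>j. j \<notin> S \<union> N \<union> C \<and>
                  Min ((\<lambda>i. w $ i) ` C) > w $ j \<and> w $ j > Max ((\<lambda>i. w $ i) ` S)))))"
proof -
  have inj: "inj (($) w)"
    using assms(9) by (auto simp: inj_on_def)
  note valid = assms(10)
  define R where "R = UNIV - (S \<union> N)"
  have disj: "S \<inter> N = {}" and card_S: "card S \<le> k"
    and C: "top_set w R (min (k - card S) (card R)) C"
    using valid by (auto simp: valid_scg_tuple_def scg_tuple_iff_top_set[OF inj] R_def)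
  have C_sub: "C \<subseteq> R" and card_C: "card C = min (k - card S) (card R)"
    and C_gt: "\<And>i j. i \<in> C \<Longrightarrow> j \<in> R - C \<Longrightarrow> w $ j < w $ i"
    using C by (auto simp: top_set_def)
  have "S \<union> N \<union> R = UNIV"
    by (auto simp: R_def)
  then have "card (S \<union> N) + card R = CARD('n)"
    by (subst card_Un_disjoint[symmetric]) (auto simp: R_def)
  then have card_R: "card S + card N + card R = CARD('n)"
    using disj by (simp add: card_Un_disjoint)
  have notin_R: "i \<notin> R" "i \<notin> C" if "i \<in> S \<union> N" for i
    using that C_sub by (auto simp: R_def)

  \<comment> \<open>Returning \<open>i\<close> to \<open>R\<close> raises the required size by one
    if \<open>card R < k - card S\<close> and leaves it unchanged otherwise. This separates case 1
    from the other two.\<close>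
  have remove_N: "valid_scg_tuple k \<gamma> gap w S (N - {i}) C \<longleftrightarrow>
      top_set w (insert i R) (min (k - card S) (Suc (card R))) C" if "i \<in> N" for i
  proof -
    have "UNIV - (S \<union> (N - {i})) = insert i R"
      using that disj by (auto simp: R_def)
    then show ?thesis
      using disj card_S notin_R(1)[of i] that
      by (auto simp: valid_remove_N_iff[OF valid] scg_tuple_iff_top_set[OF inj])
  qed
  \<comment> \<open>Both arguments of the minimum grow by one, so the required size is that of
    \<open>C \<union> {i}\<close>, and only the comparison of \<open>i\<close> with
    \<open>R - C\<close> is left.\<close>
  have move_S: "valid_scg_tuple k \<gamma> gap w (S - {i}) N (C \<union> {i}) \<longleftrightarrow> (\<forall>j\<in>R - C. w $ j < w $ i)"
    if "i \<in> S" for i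
  proof -
    have "UNIV - ((S - {i}) \<union> N) = insert i R"
      using that disj by (auto simp: R_def)
    moreover have "card S = Suc (card (S - {i}))" "card (insert i R) = Suc (card R)"
      using that notin_R(1)[of i] by (simp_all add: card_Suc_Diff1 del: card_Diff_insert)
    then have "min (k - card (S - {i})) (card (insert i R)) = Suc (card C)"
      using card_S card_C by linarith
    moreover have "(S - {i}) \<inter> N = {}" "card (S - {i}) \<le> k"
      using disj card_S that by (auto simp: card_Diff_singleton)
    ultimately have "valid_scg_tuple k \<gamma> gap w (S - {i}) N (C \<union> {i}) \<longleftrightarrow>
        top_set w (insert i R) (Suc (card C)) (C \<union> {i})"
      using valid_move_S_iff[OF valid that] notin_R(2)[of i] that
      by (simp add: scg_tuple_iff_top_set[OF inj])
    also have "\<dots> \<longleftrightarrow> (\<forall>j\<in>R - C. w $ j < w $ i)"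
      using C_sub C_gt notin_R[of i] that by (auto simp: top_set_def)
    finally show ?thesis .
  qed
  have minimal: "minimal_scg_tuple k \<gamma> gap w S N C \<longleftrightarrow>
      (\<forall>i\<in>N. \<not> top_set w (insert i R) (min (k - card S) (Suc (card R))) C) \<and>
      (\<forall>i\<in>S. \<exists>j\<in>R - C. w $ i < w $ j)"
  \<comment> \<open>Distinct components turn a failed strict inequality into the reverse strict
    one.\<close>
  proof -
    have "\<not> w $ j < w $ i \<longleftrightarrow> w $ i < w $ j" if "i \<in> S" "j \<in> R - C" for i j
    proof -
      have "i \<noteq> j" using that notin_R by auto
      then have "w $ i \<noteq> w $ j" using assms(9) by blast
      then show ?thesis by linarith
    qed
    then show ?thesis
      using valid remove_N move_S unfolding minimal_scg_tuple_def by blast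
  qed

  \<comment> \<open>Case 1: \<open>C\<close> exhausts \<open>R\<close>. It is too small once an
    index of \<open>N\<close> returns to \<open>R\<close>, and \<open>R - C\<close> offers no
    witness against any index of \<open>S\<close>.\<close>
  have "minimal_scg_tuple k \<gamma> gap w S N C \<longleftrightarrow> S = {}" if N: "card N > CARD('n) - k"
  proof -
    have lt: "card R < k - card S"
      using N card_R assms(2) by simp
    then have "C = R"
      using C_sub card_C by (intro card_subset_eq) auto
    then show ?thesis
      unfolding minimal using lt card_C by (auto simp: top_set_def)
  qed
  moreover have "minimal_scg_tuple k \<gamma> gap w S N C \<longleftrightarrow>
      N = {} \<and> Max ((\<lambda>i. w $ i) ` S) < nth_largest w UNIV 1"
    if N: "card N \<le> CARD('n) - k" and "C = {}"
  proof -
    \<comment> \<open>If instead \<open>R\<close> were empty, the bound on \<open>card N\<close>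
      would still force \<open>card S \<ge> k\<close>.\<close>
    have "card S = k"
      using N card_C card_R card_S assms(2) \<open>C = {}\<close> by auto
    then have "S \<noteq> {}"
      using assms(1) by auto
    \<comment> \<open>The required size stays 0 and the empty set always qualifies, so any index of
      \<open>N\<close> could be removed.\<close>
    have "minimal_scg_tuple k \<gamma> gap w S N C \<longleftrightarrow> N = {} \<and> (\<forall>i\<in>S. \<exists>j\<in>R. w $ i < w $ j)"
      unfolding minimal using \<open>card S = k\<close> \<open>C = {}\<close> by (auto simp: top_set_def)
    also have "\<dots> \<longleftrightarrow> N = {} \<and> Max (($) w ` S) < Max (range (($) w))"
    proof (rule conj_cong[OF refl])
      assume "N = {}"
      have "(\<forall>i\<in>S. \<exists>j\<in>R. w $ i < w $ j) \<longleftrightarrow> (\<forall>i\<in>S. \<exists>j. w $ i < w $ j)"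
      proof
        \<comment> \<open>A global maximizer \<open>m\<close> cannot lie in \<open>S\<close>; as
          \<open>N\<close> is empty it lies in \<open>R\<close> and serves as witness for every
          \<open>i\<close>.\<close>
        assume *: "\<forall>i\<in>S. \<exists>j. w $ i < w $ j"
        have "Max (range (($) w)) \<in> range (($) w)"
          by (intro Max_in) auto
        then obtain m where "w $ m = Max (range (($) w))"
          by (metis imageE)
        then have m: "w $ j \<le> w $ m" for j
          by simp
        then have "m \<notin> S"
          using * by (meson linorder_not_less)
        then have "m \<in> R"
          using \<open>N = {}\<close> by (simp add: R_def)
        then show "\<forall>i\<in>S. \<exists>j\<in>R. w $ i < w $ j"
          using * m by (meson less_le_trans)
      qed blast
      also have "\<dots> \<longleftrightarrow> (\<forall>i\<in>S. w $ i < Max (range (($) w)))"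
        by (simp add: Max_gr_iff)
      also have "\<dots> \<longleftrightarrow> Max (($) w ` S) < Max (range (($) w))"
        using \<open>S \<noteq> {}\<close> by simp
      finally show "(\<forall>i\<in>S. \<exists>j\<in>R. w $ i < w $ j) \<longleftrightarrow>
        Max (($) w ` S) < Max (range (($) w))" .
    qed
    finally show ?thesis
      using nth_largest_1[OF inj] by simp
  qed
  moreover have "minimal_scg_tuple k \<gamma> gap w S N C \<longleftrightarrow>
      (N = {} \<or> Min ((\<lambda>i. w $ i) ` N) \<ge> Min ((\<lambda>i. w $ i) ` C)) \<and>
      (S = {} \<or> (\<exists>j. j \<notin> S \<union> N \<union> C \<and>
        Min ((\<lambda>i. w $ i) ` C) > w $ j \<and> w $ j > Max ((\<lambda>i. w $ i) ` S)))"
    if N: "card N \<le> CARD('n) - k" and "C \<noteq> {}"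
  proof -
    \<comment> \<open>Case 3: the required size remains \<open>card C\<close> when \<open>i\<close>
      leaves \<open>N\<close>, so \<open>C\<close> stays a top set iff \<open>i\<close> lies below
      all of \<open>C\<close>.\<close>
    have "k - card S \<le> card R"
      using N card_R card_S assms(2) by simp
    then have c: "card C = k - card S" "min (k - card S) (Suc (card R)) = card C"
      using card_C by auto
    have "\<not> top_set w (insert i R) (card C) C \<longleftrightarrow> Min (($) w ` C) \<le> w $ i" if "i \<in> N" for i
    proof -
      have "top_set w (insert i R) (card C) C \<longleftrightarrow> (\<forall>j\<in>C. w $ i < w $ j)"
        using C_sub C_gt notin_R[of i] that by (auto simp: top_set_def)
      also have "\<dots> \<longleftrightarrow> w $ i < Min (($) w ` C)"
        using \<open>C \<noteq> {}\<close> by simp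
      finally show ?thesis by auto
    qed
    then have "(\<forall>i\<in>N. \<not> top_set w (insert i R) (min (k - card S) (Suc (card R))) C) \<longleftrightarrow>
        N = {} \<or> Min (($) w ` C) \<le> Min (($) w ` N)"
      using c by (cases "N = {}") auto
    moreover have "(\<forall>i\<in>S. \<exists>j\<in>R - C. w $ i < w $ j) \<longleftrightarrow>
        S = {} \<or> (\<exists>j. j \<notin> S \<union> N \<union> C \<and> w $ j < Min (($) w ` C) \<and> Max (($) w ` S) < w $ j)"
    proof (cases "S = {}")
      case False
      \<comment> \<open>The witness for the index of \<open>S\<close> with the largest value works
        for all of \<open>S\<close>.\<close>
      have "(\<forall>i\<in>S. \<exists>j\<in>R - C. w $ i < w $ j) \<longleftrightarrow> (\<exists>j\<in>R - C. Max (($) w ` S) < w $ j)"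
      proof
        assume "\<forall>i\<in>S. \<exists>j\<in>R - C. w $ i < w $ j"
        moreover have "Max (($) w ` S) \<in> ($) w ` S"
          using False by (intro Max_in) auto
        ultimately show "\<exists>j\<in>R - C. Max (($) w ` S) < w $ j"
          by auto
      qed (use False in auto)
      \<comment> \<open>Membership in \<open>R - C\<close> supplies the upper bound on
        \<open>w $ j\<close> in condition (2).\<close>
      moreover have "w $ j < Min (($) w ` C)" if "j \<in> R - C" for j
        using that C_gt \<open>C \<noteq> {}\<close> by simp
      ultimately show ?thesis
        using False by (auto simp: R_def)
    qed simp
    ultimately show ?thesis
      unfolding minimal by simp
  qed
  ultimately show ?thesis
    by blast
qed

end
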